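(* Let $n \ge 3$, $2 \le k \le n-1$ and $b \ge 1$ be integers, let $G = T(n,(k,b))$ and $t(v_i) = t(G, v_i, v_n)$. Then \[ t(v_i) = \begin{cases} n^2 - k^2 + 2(b-1)(n-k) + (k-1)^2 - (i-1)^2, & 1 \le i \le k-1,\\ n^2 - i^2 + 2(b-1)(n-i), & k \le i \le n-1. \end{cases} \]
   Context: $T(n,(k,b))$ is the tree consisting of a path (spine) $v_1 v_2 \cdots v_n$ together with $b$ leaves $u_1,\ldots,u_b$, each adjacent only to the spine vertex $v_k$. $t(G,v,u)$ denotes the expected number of steps until a simple random walk on $G$ started at $v$ (moving each step to a uniformly random neighbor) first reaches $u$. *)

theory Defs
  imports "HOL-Probability.Probability" "Graph_Theory.Graph_Theory"
begin

section \<open>The tree\<close>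

datatype tree_vertex = Spine nat | Leaf nat

text \<open>Simple graphs are rendered as symmetric, loop-free pair digraphs, hence the symmetric closure.\<close>

definition spine_tree :: "nat \<Rightarrow> nat \<Rightarrow> nat \<Rightarrow> tree_vertex pair_pre_digraph" where
  "spine_tree n k b =
     \<lparr> pverts = Spine ` {1..n} \<union> Leaf ` {1..b},
       parcs = symcl ({(Spine i, Spine (i + 1)) | i. 1 \<le> i \<and> i < n} \<union>
                      {(Spine k, Leaf j) | j. 1 \<le> j \<and> j \<le> b}) \<rparr>"

lemma pair_graph_spine_tree:
  assumes "1 \<le> k" "k \<le> n"
  shows "pair_graph (spine_tree n k b)"
proof -
  let ?G = "spine_tree n k b"
  have wf: "fst e \<in> pverts ?G \<and> snd e \<in> pverts ?G \<and> fst e \<noteq> snd e" if "e \<in> parcs ?G" for e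
    using that assms by (auto simp: spine_tree_def symcl_def)
  then have "parcs ?G \<subseteq> pverts ?G \<times> pverts ?G"
    by (auto simp: mem_Times_iff)
  moreover have fin: "finite (pverts ?G)"
    by (simp add: spine_tree_def)
  ultimately have "finite (parcs ?G)"
    by (meson finite_SigmaI finite_subset)
  moreover have "symmetric (with_proj ?G)"
    by (force simp: symmetric_def sym_def spine_tree_def symcl_def)
  ultimately show ?thesis
    using wf fin by unfold_locales auto
qed


section \<open>Simple random walk\<close>

text \<open>One step: a uniformly random neighbour. This is meaningful only where the set of neighbours is
  finite and nonempty.\<close>

definition srw_step :: "'v pair_pre_digraph \<Rightarrow> 'v \<Rightarrow> 'v pmf" where
  "srw_step G x = pmf_of_set (parcs G `` {x})"

text \<open>The law of the position at time \<open>i\<close>, given the positions \<open>\<omega> 0, \<dots>, \<omega> (i - 1)\<close>.\<close>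

definition srw_kernel :: "'v pair_pre_digraph \<Rightarrow> 'v \<Rightarrow> nat \<Rightarrow> (nat \<Rightarrow> 'v) \<Rightarrow> 'v measure" where
  "srw_kernel G v i \<omega> = measure_pmf (if i = 0 then return_pmf v else srw_step G (\<omega> (i - 1)))"

text \<open>The law of the whole trajectory of the walk started at \<open>v\<close>, by the Ionescu-Tulcea theorem.\<close>

definition srw :: "'v pair_pre_digraph \<Rightarrow> 'v \<Rightarrow> (nat \<Rightarrow> 'v) measure" where
  "srw G v = projective_family.lim UNIV
     (Ionescu_Tulcea.CI (srw_kernel G v) (\<lambda>_. count_space UNIV)) (\<lambda>_. count_space UNIV)"

lemma Ionescu_Tulcea_srw: "Ionescu_Tulcea (srw_kernel G v) (\<lambda>_. count_space UNIV)"
proof (rule Ionescu_Tulcea.intro)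
  fix i :: nat
  let ?S = "\<lambda>_ :: nat. count_space (UNIV :: 'a set)"
  show "srw_kernel G v i \<in> PiM {0..<i} ?S \<rightarrow>\<^sub>M subprob_algebra (count_space UNIV)"
  proof (cases i)
    case (Suc j)
    have "(\<lambda>x. measure_pmf (srw_step G x)) \<in> count_space UNIV \<rightarrow>\<^sub>M subprob_algebra (count_space UNIV)"
      by (simp add: measure_pmf_in_subprob_algebra)
    then have "(\<lambda>\<omega>. measure_pmf (srw_step G (\<omega> j)))
        \<in> PiM {0..<i} ?S \<rightarrow>\<^sub>M subprob_algebra (count_space UNIV)"
      using Suc by (intro measurable_compose[OF measurable_component_singleton]) auto
    then show ?thesis
      by (simp add: Suc srw_kernel_def[abs_def])
  qed (simp add: srw_kernel_def[abs_def] measure_pmf_in_subprob_algebra)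
next
  show "prob_space (srw_kernel G v i \<omega>)" for i and \<omega>
    by (simp add: srw_kernel_def prob_space_measure_pmf)
qed

lemma prob_space_srw: "prob_space (srw G v)"
proof -
  interpret Ionescu_Tulcea "srw_kernel G v" "\<lambda>_. count_space UNIV"
    by (rule Ionescu_Tulcea_srw)
  have "emeasure PF.lim (PF.emb UNIV {} (space (PiM {} (\<lambda>_. count_space UNIV)))) = 1"
    using PF.prob_space_P[of "{}"] by (subst lim) (simp_all add: prob_space.emeasure_space_1[symmetric] PF.space_P)
  then show ?thesis
    by (intro prob_spaceI) (simp add: srw_def space_PiM prod_emb_def restrict_def)
qed

lemma space_srw [simp]: "space (srw G v) = UNIV"
  and sets_srw [measurable_cong]: "sets (srw G v) = sets (PiM UNIV (\<lambda>_. count_space UNIV))"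
proof -
  interpret Ionescu_Tulcea "srw_kernel G v" "\<lambda>_. count_space UNIV"
    by (rule Ionescu_Tulcea_srw)
  show "space (srw G v) = UNIV" "sets (srw G v) = sets (PiM UNIV (\<lambda>_. count_space UNIV))"
    by (simp_all add: srw_def space_PiM)
qed

lemma emeasure_srw_cylinder:
  "emeasure (srw G v) {\<omega>. \<forall>i\<le>m. \<omega> i = x i} =
     (if x 0 = v then \<Prod>i<m. ennreal (pmf (srw_step G (x i)) (x (Suc i))) else 0)"
proof -
  let ?S = "\<lambda>_ :: nat. count_space (UNIV :: 'a set)"
  interpret Ionescu_Tulcea "srw_kernel G v" ?S
    by (rule Ionescu_Tulcea_srw)
  define R where "R n = restrict x {0..<n}" for n
  have R_PiE: "{R n} = (\<Pi>\<^sub>E i\<in>{0..<n}. {x i})" for n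
    
    by (auto simp: R_def PiE_iff extensional_def fun_eq_iff restrict_def)
  have R_sets [measurable]: "{R n} \<in> sets (PiM {0..<n} ?S)" for n
    unfolding R_PiE by (intro sets_PiM_I_finite) auto
  have R_space: "R n \<in> space (PiM {0..<n} ?S)" for n
    by (simp add: R_def space_PiM)
  have C_Suc: "emeasure (C 0 (Suc n) (\<lambda>_. undefined)) {R (Suc n)} =
      emeasure (srw_kernel G v n (R n)) {x n} * emeasure (C 0 n (\<lambda>_. undefined)) {R n}" for n
  proof -
    have "emeasure (C 0 (Suc n) (\<lambda>_. undefined)) {R (Suc n)} =
        (\<integral>\<^sup>+\<omega>. emeasure (eP n \<omega>) {R (Suc n)} \<partial>C 0 n (\<lambda>_. undefined))"
      using measurable_eP[of n] R_sets[of "Suc n"]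
      by (simp add: emeasure_bind[where N = "PiM {0..<Suc n} ?S"] space_C
          measurable_cong_sets[OF sets_C])
    also have "\<dots> = (\<integral>\<^sup>+\<omega>. emeasure (srw_kernel G v n (R n)) {x n} * indicator {R n} \<omega>
        \<partial>C 0 n (\<lambda>_. undefined))"
    proof (intro nn_integral_cong)
      fix \<omega> assume "\<omega> \<in> space (C 0 n (\<lambda>_. undefined))"
      then have \<omega>: "\<omega> \<in> space (PiM {0..<n} ?S)"
        by (simp add: space_C)
      have "fun_upd \<omega> n y = R (Suc n) \<longleftrightarrow> \<omega> = R n \<and> y = x n" for y
        using \<omega> by (auto simp: R_def space_PiM PiE_def extensional_def fun_eq_iff restrict_def less_Suc_eq)
      then have "(\<lambda>y. fun_upd \<omega> n y) -` {R (Suc n)} = (if \<omega> = R n then {x n} else {})"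
        by auto
      then show "emeasure (eP n \<omega>) {R (Suc n)} =
          emeasure (srw_kernel G v n (R n)) {x n} * indicator {R n} \<omega>"
        using \<omega> by (simp add: emeasure_eP split: split_indicator)
    qed
    also have "\<dots> = emeasure (srw_kernel G v n (R n)) {x n} * emeasure (C 0 n (\<lambda>_. undefined)) {R n}"
      by (subst nn_integral_cmult_indicator) (simp_all add: sets_C)
    finally show ?thesis .
  qed
  have C_R: "emeasure (C 0 (Suc n) (\<lambda>_. undefined)) {R (Suc n)} =
      (if x 0 = v then \<Prod>i<n. ennreal (pmf (srw_step G (x i)) (x (Suc i))) else 0)" for n
  proof (induction n)
    case 0
    have "emeasure (C 0 0 (\<lambda>_. undefined)) {R 0} = 1"
      using R_sets[of 0] by (simp add: R_def restrict_def)
    then show ?case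
      by (subst C_Suc) (simp add: srw_kernel_def emeasure_pmf_single)
  next
    case (Suc n)
    have "R (Suc n) n = x n"
      by (simp add: R_def)
    then show ?case
      by (subst C_Suc, subst Suc.IH) (simp add: srw_kernel_def emeasure_pmf_single mult.commute)
  qed
  have "{\<omega>. \<forall>i\<le>m. \<omega> i = x i} = PF.emb UNIV {0..<Suc m} {R (Suc m)}"
    unfolding R_PiE by (auto simp: prod_emb_def space_PiM PiE_iff less_Suc_eq_le)
  then have "emeasure (srw G v) {\<omega>. \<forall>i\<le>m. \<omega> i = x i} = emeasure (CI {0..<Suc m}) {R (Suc m)}"
    unfolding srw_def by (simp only: lim[OF finite_atLeastLessThan R_sets])
  also have "\<dots> = emeasure (C 0 (Suc m) (\<lambda>_. undefined)) {R (Suc m)}"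
    by (subst emeasure_CI[OF order_refl R_sets])
       (simp add: prod_emb_id[OF sets.sets_into_space[OF R_sets, unfolded space_PiM]])
  finally show ?thesis
    by (simp only: C_R)
qed


section \<open>Expected hitting times\<close>

text \<open>The value is \<open>\<infinity>\<close> if \<open>u\<close> is never visited, since the infimum of the empty set in
  \<^typ>\<open>ennreal\<close> is \<open>\<infinity>\<close>.\<close>

definition hitting_time :: "'v \<Rightarrow> (nat \<Rightarrow> 'v) \<Rightarrow> ennreal" where
  "hitting_time u \<omega> = (INF m\<in>{m. \<omega> m = u}. of_nat m)"

lemma measurable_hitting_time [measurable]:
  "hitting_time u \<in> borel_measurable (PiM UNIV (\<lambda>_. count_space UNIV))"
proof -
  have "hitting_time u = (\<lambda>\<omega>. INF m. if \<omega> m = u then of_nat m else top)"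
    unfolding hitting_time_def
  proof (intro ext antisym INF_greatest)
    fix \<omega> :: "nat \<Rightarrow> 'a" and m
    assume "m \<in> {m. \<omega> m = u}"
    then show "(INF m. if \<omega> m = u then of_nat m else top) \<le> (of_nat m :: ennreal)"
      by (intro INF_lower2[of m]) auto
  qed (auto intro: INF_lower)
  moreover have "(\<lambda>\<omega>. INF m. if \<omega> m = u then of_nat m else top :: ennreal)
      \<in> borel_measurable (PiM UNIV (\<lambda>_. count_space UNIV))"
    by measurable
  ultimately show ?thesis
    by simp
qed

definition expected_hitting_time :: "'v pair_pre_digraph \<Rightarrow> 'v \<Rightarrow> 'v \<Rightarrow> ennreal" where
  "expected_hitting_time G v u = (\<integral>\<^sup>+\<omega>. hitting_time u \<omega> \<partial>srw G v)"

end

theory Submission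
  imports Defs
begin

text \<open>The claimed values, extended by \<open>t (Leaf j) = t (Spine k) + 1\<close> and \<open>t (Spine n) = 0\<close>, solve the
  first-step equations \<open>h x = 1 + E (h (X 1))\<close> for \<open>x \<noteq> u\<close>, \<open>h u = 0\<close>, and a
  solution with \<open>0 \<le> h \<le> C\<close> gives the expected hitting time \<open>E T\<close> of \<open>u\<close> from \<open>v\<close>: with \<open>M m = E (h (X m); T > m)\<close> the equations say
  \<open>M m = P (T > m) + M (m + 1)\<close>, so the sum of all \<open>P (T > m)\<close> is at most \<open>M 0 = h v\<close>. Hence
  \<open>P (T > m)\<close> tends to \<open>0\<close>, and so does \<open>M m \<le> C * P (T > m)\<close>; the sum, which is \<open>E T\<close>, is therefore
  equal to \<open>h v\<close>. Almost sure finiteness of \<open>T\<close> need not be shown beforehand.\<close>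

section \<open>Finite-dimensional laws and the one-step Markov property\<close>

lemma measurable_stay_in:
  "Measurable.pred (PiM UNIV (\<lambda>_. count_space UNIV)) (\<lambda>\<omega>. \<forall>i\<le>m. \<omega> i \<in> A)" for m :: nat
proof -
  let ?M = "PiM (UNIV :: nat set) (\<lambda>_. count_space UNIV)"
  have "Measurable.pred ?M (\<lambda>\<omega>. \<omega> i \<in> A)" for i
    by (rule measurable_compose[OF
          measurable_component_singleton[where M = "\<lambda>_. count_space UNIV", OF UNIV_I]
          measurable_count_space])
  then have "Measurable.pred ?M (\<lambda>\<omega>. \<forall>i\<in>{..m}. \<omega> i \<in> A)"
    by (rule pred_intros_finite(3)[OF finite_atMost])
  then show ?thesis
    by (simp only: Ball_def atMost_iff)
qed

text \<open>The trajectory measure is a projective limit whose marginals on initial segments are the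
  laws \<open>C 0 n\<close>. Moving integrals to \<open>C 0 n\<close> makes its recursion along the
  kernels available.\<close>

lemma nn_integral_srw_restrict:
  fixes f :: "(nat \<Rightarrow> 'v) \<Rightarrow> ennreal"
  assumes "f \<in> borel_measurable (PiM {0..<n} (\<lambda>_. count_space UNIV))"
  shows "(\<integral>\<^sup>+\<omega>. f (restrict \<omega> {0..<n}) \<partial>srw G v) =
    (\<integral>\<^sup>+\<omega>. f \<omega> \<partial>Ionescu_Tulcea.C (srw_kernel G v) (\<lambda>_. count_space UNIV) 0 n (\<lambda>_. undefined))"
proof -
  let ?S = "\<lambda>_ :: nat. count_space (UNIV :: 'v set)"
  interpret Ionescu_Tulcea "srw_kernel G v" ?S
    by (rule Ionescu_Tulcea_srw)
  \<comment> \<open>\<open>CI J\<close> projects the law of the first \<open>up_to J\<close>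
    positions to \<open>J\<close>; for an initial segment nothing is projected away.\<close>
  have up_to_eq: "up_to {0..<n} = n"
    using up_to[of "{0..<n}"] by (intro antisym) (auto simp: up_to_iff ivl_subset)
  have "CI {0..<n} = C 0 n (\<lambda>_. undefined)"
    using distr_C[of n n "\<lambda>_. undefined" 0] by (simp add: CI_def up_to_eq space_PiM)
  then have "distr (srw G v) (PiM {0..<n} ?S) (\<lambda>\<omega>. restrict \<omega> {0..<n}) = C 0 n (\<lambda>_. undefined)"
    unfolding srw_def using distr_lim[of "{0..<n}"] by simp
  moreover have "(\<lambda>\<omega>. restrict \<omega> {0..<n}) \<in> srw G v \<rightarrow>\<^sub>M PiM {0..<n} ?S"
    by (simp add: measurable_cong_sets[OF sets_srw refl] measurable_restrict_subset)
  then have "(\<integral>\<^sup>+\<omega>. f \<omega> \<partial>distr (srw G v) (PiM {0..<n} ?S) (\<lambda>\<omega>. restrict \<omega> {0..<n})) =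
      (\<integral>\<^sup>+\<omega>. f (restrict \<omega> {0..<n}) \<partial>srw G v)"
    by (rule nn_integral_distr) (simp add: assms)
  ultimately show ?thesis
    by (simp only:)
qed

text \<open>The law of \<open>m + 2\<close> positions arises from that of \<open>m + 1\<close>
  positions by one kernel step, which depends only on \<open>\<omega> m\<close>. The indicator
  ignores the new position and leaves the inner integral. This is the Markov property for events of
  the kind \<open>T > m\<close>.\<close>

lemma nn_integral_srw_Suc:
  fixes g :: "'v \<Rightarrow> ennreal"
  shows "(\<integral>\<^sup>+\<omega>. indicator {\<omega>. \<forall>i\<le>m. \<omega> i \<in> A} \<omega> * g (\<omega> (Suc m)) \<partial>srw G v) =
    (\<integral>\<^sup>+\<omega>. indicator {\<omega>. \<forall>i\<le>m. \<omega> i \<in> A} \<omega> * (\<integral>\<^sup>+y. g y \<partial>srw_step G (\<omega> m)) \<partial>srw G v)"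
proof -
  let ?S = "\<lambda>_ :: nat. count_space (UNIV :: 'v set)"
  interpret Ionescu_Tulcea "srw_kernel G v" ?S
    by (rule Ionescu_Tulcea_srw)
  define F :: "(nat \<Rightarrow> 'v) \<Rightarrow> ennreal" where "F \<omega> = indicator {\<omega>. \<forall>i\<le>m. \<omega> i \<in> A} \<omega>" for \<omega>
  define E where "E x = (\<integral>\<^sup>+y. g y \<partial>srw_step G x)" for x
  have F_meas: "F \<in> borel_measurable (PiM {0..<n} ?S)" if "m < n" for n
  proof -
    \<comment> \<open>Written as a product of coordinate indicators, \<open>F\<close> is measurable
      factor by factor.\<close>
    have "F = (\<lambda>\<omega>. \<Prod>i\<in>{..m}. indicator A (\<omega> i))"
      by (auto simp: F_def fun_eq_iff indicator_def prod_zero_iff)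
    also have "\<dots> \<in> borel_measurable (PiM {0..<n} ?S)"
      using that by (intro borel_measurable_prod_ennreal
          measurable_compose[OF measurable_component_singleton]) auto
    finally show ?thesis .
  qed
  have comp: "(\<lambda>\<omega>. k (\<omega> j)) \<in> borel_measurable (PiM {0..<n} ?S)" if "j < n" for j n and k :: "'v \<Rightarrow> ennreal"
    using that by (intro measurable_compose[OF measurable_component_singleton]) auto
  have F_comp: "(\<lambda>\<omega>. F \<omega> * k (\<omega> j)) \<in> borel_measurable (PiM {0..<n} ?S)"
    if "m < n" "j < n" for n j and k :: "'v \<Rightarrow> ennreal"
    using that by (intro borel_measurable_times_ennreal F_meas comp)
  have F_restrict: "F (restrict \<omega> {0..<n}) = F \<omega>" if "m < n" for \<omega> n
    using that by (auto simp: F_def indicator_def)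
  \<comment> \<open>The positions at times \<open>0\<close> to \<open>Suc m\<close> have index set
    \<open>{0..<Suc (Suc m)}\<close>, hence the stage \<open>Suc (Suc m)\<close>.\<close>
  have "(\<integral>\<^sup>+\<omega>. F \<omega> * g (\<omega> (Suc m)) \<partial>srw G v) =
      (\<integral>\<^sup>+\<omega>. F \<omega> * g (\<omega> (Suc m)) \<partial>C 0 (Suc (Suc m)) (\<lambda>_. undefined))"
    using nn_integral_srw_restrict[of "\<lambda>\<omega>. F \<omega> * g (\<omega> (Suc m))" "Suc (Suc m)" G v]
      F_comp[of "Suc (Suc m)" "Suc m" g]
    by (simp add: F_restrict del: C.simps)
  also have "\<dots> = (\<integral>\<^sup>+\<omega>. (\<integral>\<^sup>+\<omega>'. F \<omega>' * g (\<omega>' (Suc m)) \<partial>eP (Suc m) \<omega>) \<partial>C 0 (Suc m) (\<lambda>_. undefined))"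
    using F_comp[of "Suc (Suc m)" "Suc m" g] measurable_eP[of "Suc m"]
    by (subst C.simps(2), subst nn_integral_bind[where B = "PiM {0..<Suc (Suc m)} ?S"])
      (simp_all add: measurable_cong_sets[OF sets_C] space_PiM del: C.simps)
  also have "\<dots> = (\<integral>\<^sup>+\<omega>. F \<omega> * E (\<omega> m) \<partial>C 0 (Suc m) (\<lambda>_. undefined))"
  proof (intro nn_integral_cong)
    fix \<omega> assume "\<omega> \<in> space (C 0 (Suc m) (\<lambda>_. undefined))"
    then have \<omega>: "\<omega> \<in> space (PiM {0..<Suc m} ?S)"
      by (simp add: space_C space_PiM del: C.simps)
    have "F (fun_upd \<omega> (Suc m) y) = F \<omega>" for y
      by (auto simp: F_def indicator_def)
    then show "(\<integral>\<^sup>+\<omega>'. F \<omega>' * g (\<omega>' (Suc m)) \<partial>eP (Suc m) \<omega>) = F \<omega> * E (\<omega> m)"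
      using F_comp[of "Suc (Suc m)" "Suc m" g]
      by (subst nn_integral_eP[OF \<omega>])
        (simp_all add: srw_kernel_def E_def nn_integral_cmult)
  qed
  also have "\<dots> = (\<integral>\<^sup>+\<omega>. F \<omega> * E (\<omega> m) \<partial>srw G v)"
    using nn_integral_srw_restrict[of "\<lambda>\<omega>. F \<omega> * E (\<omega> m)" "Suc m" G v]
      F_comp[of "Suc m" m E]
    by (simp add: F_restrict del: C.simps)
  finally show ?thesis
    by (simp add: F_def E_def)
qed

section \<open>Almost sure behaviour of the walk and expected hitting times\<close>

lemma AE_srw_0: "AE \<omega> in srw G v. \<omega> 0 = v"
proof -
  interpret prob_space "srw G v"
    by (rule prob_space_srw)
  have "emeasure (srw G v) {\<omega>. \<omega> 0 = v} = 1"
    using emeasure_srw_cylinder[of G v 0 "\<lambda>_. v"] by simp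
  then show ?thesis
    using measurable_stay_in[of 0 "{v}"]
    by (intro AE_I_eq_1) (simp_all add: pred_def space_PiM)
qed

lemma measurable_srw_component: "(\<lambda>\<omega>. f (\<omega> i)) \<in> borel_measurable (srw G v)"
  for f :: "'v \<Rightarrow> ennreal"
  by (simp add: measurable_cong_sets[OF sets_srw refl]
      measurable_compose[OF measurable_component_singleton])

text \<open>Induction on time: the Markov property with the trivial event \<open>A = UNIV\<close>
  turns the probability of being outside \<open>V\<close> one step later into an integral of zeros.
  It allows first-step equations to be assumed on \<open>V\<close> only.\<close>

lemma AE_srw_closed:
  assumes "v \<in> V" and closed: "\<And>x. x \<in> V \<Longrightarrow> set_pmf (srw_step G x) \<subseteq> V"
  shows "AE \<omega> in srw G v. \<forall>i. \<omega> i \<in> V"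
  unfolding AE_all_countable
proof
  fix m
  show "AE \<omega> in srw G v. \<omega> m \<in> V"
  proof (induction m)
    case 0
    show ?case
      using AE_srw_0[of v G] by eventually_elim (simp add: \<open>v \<in> V\<close>)
  next
    case (Suc m)
    have "(\<integral>\<^sup>+\<omega>. indicator (- V) (\<omega> (Suc m)) \<partial>srw G v) =
        (\<integral>\<^sup>+\<omega>. (\<integral>\<^sup>+y. indicator (- V) y \<partial>srw_step G (\<omega> m)) \<partial>srw G v)"
      using nn_integral_srw_Suc[of G v m UNIV "indicator (- V)"] by simp
    also have "\<dots> = (\<integral>\<^sup>+\<omega>. 0 \<partial>srw G v)"
    proof (rule nn_integral_cong_AE, rule AE_mp[OF Suc.IH], rule AE_I2, rule impI)
      fix \<omega> assume "\<omega> m \<in> V"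
      then have "AE y in srw_step G (\<omega> m). indicator (- V) y = (0 :: ennreal)"
        using closed by (auto simp: AE_measure_pmf_iff indicator_def)
      then show "(\<integral>\<^sup>+y. indicator (- V) y \<partial>srw_step G (\<omega> m)) = 0"
        by (simp add: nn_integral_0_iff_AE del: nn_integral_indicator)
    qed
    finally have "AE \<omega> in srw G v. indicator (- V) (\<omega> (Suc m)) = (0 :: ennreal)"
      by (simp add: nn_integral_0_iff_AE measurable_srw_component)
    then show ?case
      by eventually_elim (simp add: indicator_def split: if_splits)
  qed
qed

text \<open>The tail-sum formula for \<open>T\<close>, path by path: the times \<open>m\<close> with
  \<open>T > m\<close> are exactly those below \<open>T\<close>, and all of them if \<open>u\<close>
  is never visited.\<close>

lemma hitting_time_eq_suminf:
  "hitting_time u \<omega> = (\<Sum>m. indicator {\<omega>. \<forall>i\<le>m. \<omega> i \<in> - {u}} \<omega>)"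
proof (cases "\<exists>m. \<omega> m = u")
  case True
  define k where "k = (LEAST m. \<omega> m = u)"
  have k: "\<omega> k = u"
    using True unfolding k_def by (rule LeastI_ex)
  have less: "\<omega> i \<noteq> u" if "i < k" for i
    using that not_less_Least unfolding k_def by blast
  have "(\<Sum>m. indicator {\<omega>. \<forall>i\<le>m. \<omega> i \<in> - {u}} \<omega> :: ennreal) = (\<Sum>m<k. indicator {\<omega>. \<forall>i\<le>m. \<omega> i \<in> - {u}} \<omega>)"
    using k by (intro suminf_finite) (auto simp: indicator_def not_less)
  also have "\<dots> = (\<Sum>m<k. 1)"
    using less by (intro sum.cong) (auto simp: indicator_def)
  also have "\<dots> = of_nat k"
    by simp
  also have "\<dots> = hitting_time u \<omega>"
    unfolding hitting_time_def
  proof (rule antisym)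
    show "of_nat k \<le> (INF m\<in>{m. \<omega> m = u}. of_nat m :: ennreal)"
      using less by (intro INF_greatest) (auto simp: not_less[symmetric])
    show "(INF m\<in>{m. \<omega> m = u}. of_nat m :: ennreal) \<le> of_nat k"
      using k by (intro INF_lower) auto
  qed
  finally show ?thesis ..
next
  case False
  then have "(\<Sum>m. indicator {\<omega>. \<forall>i\<le>m. \<omega> i \<in> - {u}} \<omega>) = (\<Sum>m. 1 :: ennreal)"
    by (intro suminf_cong) (auto simp: indicator_def)
  also have "\<dots> = top"
  proof (rule ccontr)
    assume "(\<Sum>m::nat. 1 :: ennreal) \<noteq> top"
    then have "summable (\<lambda>m::nat. 1 :: real)"
      using summable_suminf_not_top[of "\<lambda>_. 1"] by simp
    then show False
      by (simp add: summable_const_iff)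
  qed
  finally show ?thesis
    using False by (simp add: hitting_time_def)
qed

text \<open>\<open>V\<close> confines the walk, so bound and equations are needed only there. The
  bound is a real number because infinite values could also solve the equations.\<close>

lemma expected_hitting_time_eqI:
  fixes h :: "'v \<Rightarrow> ennreal"
  assumes v: "v \<in> V"
    and closed: "\<And>x. x \<in> V \<Longrightarrow> set_pmf (srw_step G x) \<subseteq> V"
    and bound: "\<And>x. x \<in> V \<Longrightarrow> h x \<le> ennreal C"
    and h_u: "h u = 0"
    and h_step: "\<And>x. x \<in> V \<Longrightarrow> x \<noteq> u \<Longrightarrow> h x = 1 + (\<integral>\<^sup>+y. h y \<partial>srw_step G x)"
  shows "expected_hitting_time G v u = h v"
proof -
  interpret prob_space "srw G v"
    by (rule prob_space_srw)
  \<comment> \<open>\<open>B m\<close> is the event \<open>T > m\<close>; \<open>Q m\<close> below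
    is its probability.\<close>
  define B :: "nat \<Rightarrow> (nat \<Rightarrow> 'v) set" where "B m = {\<omega>. \<forall>i\<le>m. \<omega> i \<in> - {u}}" for m
  have B_meas [measurable]: "B m \<in> sets (srw G v)" for m
    unfolding B_def sets_srw
    using measurable_stay_in[of m "- {u}"] by (simp add: pred_def space_PiM)
  note h_meas [measurable] = measurable_srw_component[of h]
  define M where "M m = (\<integral>\<^sup>+\<omega>. indicator (B m) \<omega> * h (\<omega> m) \<partial>srw G v)" for m
  define Q where "Q m = emeasure (srw G v) (B m)" for m
  have AE_V: "AE \<omega> in srw G v. \<forall>i. \<omega> i \<in> V"
    using v closed by (rule AE_srw_closed)
  \<comment> \<open>If \<open>v = u\<close>, then \<open>B 0\<close> is a null event, but
    \<open>h v = 0\<close> as well.\<close>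
  have M_0: "M 0 = h v"
  proof -
    have "M 0 = (\<integral>\<^sup>+\<omega>. h v \<partial>srw G v)"
      unfolding M_def using AE_srw_0[of v G]
      by (intro nn_integral_cong_AE, eventually_elim) (auto simp: B_def indicator_def h_u)
    then show ?thesis
      by (simp add: emeasure_space_1[simplified])
  qed
  have M_Suc: "M m = Q m + M (Suc m)" for m
  proof -
    have "M m = (\<integral>\<^sup>+\<omega>. indicator (B m) \<omega> * (1 + (\<integral>\<^sup>+y. h y \<partial>srw_step G (\<omega> m))) \<partial>srw G v)"
      unfolding M_def using AE_V
      by (intro nn_integral_cong_AE, eventually_elim) (auto simp: B_def indicator_def h_step)
    also have "\<dots> = Q m + (\<integral>\<^sup>+\<omega>. indicator (B m) \<omega> * (\<integral>\<^sup>+y. h y \<partial>srw_step G (\<omega> m)) \<partial>srw G v)"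
      unfolding Q_def
      by (simp add: distrib_left nn_integral_add measurable_srw_component)
    also have "(\<integral>\<^sup>+\<omega>. indicator (B m) \<omega> * (\<integral>\<^sup>+y. h y \<partial>srw_step G (\<omega> m)) \<partial>srw G v) =
        (\<integral>\<^sup>+\<omega>. indicator (B m) \<omega> * h (\<omega> (Suc m)) \<partial>srw G v)"
      unfolding B_def by (rule nn_integral_srw_Suc[symmetric])
    \<comment> \<open>\<open>B m\<close> may be replaced by \<open>B (Suc m)\<close>: they differ
      only on paths with \<open>\<omega> (Suc m) = u\<close>, where \<open>h\<close>
      vanishes.\<close>
    also have "\<dots> = M (Suc m)"
      unfolding M_def using h_u
      by (intro nn_integral_cong) (auto simp: B_def indicator_def le_Suc_eq)
    finally show ?thesis .
  qed
  have h_v: "h v = (\<Sum>m<N. Q m) + M N" for N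
    by (induction N) (simp_all add: M_0 add.assoc M_Suc[symmetric])
  have "(\<Sum>m<N. Q m) \<le> h v" for N
    by (subst h_v[of N]) simp
  then have "(\<Sum>m. Q m) \<le> h v"
    by (intro suminf_le_const) simp_all
  \<comment> \<open>Finiteness of \<open>h v\<close> is what makes the tail probabilities summable,
    so that they tend to \<open>0\<close>.\<close>
  also have "\<dots> < top"
    using bound[OF v] by (simp add: le_less_trans)
  finally have "summable (\<lambda>m. prob (B m))"
    by (intro summable_suminf_not_top) (simp_all add: Q_def emeasure_eq_measure)
  then have "(\<lambda>m. ennreal C * Q m) \<longlonglongrightarrow> ennreal C * 0"
    unfolding Q_def emeasure_eq_measure ennreal_0[symmetric]
    by (intro ennreal_tendsto_cmult tendsto_ennrealI summable_LIMSEQ_zero) simp_all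
  moreover have "M m \<le> ennreal C * Q m" for m
  proof -
    have "M m \<le> (\<integral>\<^sup>+\<omega>. ennreal C * indicator (B m) \<omega> \<partial>srw G v)"
      unfolding M_def using AE_V
      by (intro nn_integral_mono_AE, eventually_elim) (auto simp: indicator_def bound)
    then show ?thesis
      by (simp add: Q_def nn_integral_cmult_indicator)
  qed
  ultimately have "M \<longlonglongrightarrow> 0"
    by (intro tendsto_sandwich[of "\<lambda>_. 0" M _ "\<lambda>m. ennreal C * Q m"]) simp_all
  then have "(\<lambda>N. (\<Sum>m<N. Q m) + M N) \<longlonglongrightarrow> (\<Sum>m. Q m) + 0"
    by (intro tendsto_add summable_LIMSEQ) simp_all
  \<comment> \<open>By \<open>h_v\<close> the convergent sequence is constantly
    \<open>h v\<close>.\<close>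
  then have "h v = (\<Sum>m. Q m)"
    by (simp add: h_v[symmetric] LIMSEQ_const_iff)
  also have "\<dots> = expected_hitting_time G v u"
    unfolding expected_hitting_time_def hitting_time_eq_suminf B_def[symmetric] Q_def
    by (subst nn_integral_suminf) simp_all
  finally show ?thesis ..
qed

text \<open>On a finite \<open>V\<close> the maximum of \<open>h\<close> serves as the bound. The
  first-step equation is multiplied by the degree, so that checking it on a concrete graph involves
  real arithmetic without division.\<close>

lemma expected_hitting_time_finite_eqI:
  fixes h :: "'v \<Rightarrow> real"
  assumes fin: "finite V" and v: "v \<in> V"
    and closed: "\<And>x. x \<in> V \<Longrightarrow> parcs G `` {x} \<noteq> {} \<and> parcs G `` {x} \<subseteq> V"
    and nonneg: "\<And>x. x \<in> V \<Longrightarrow> 0 \<le> h x"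
    and h_u: "h u = 0"
    and h_step: "\<And>x. x \<in> V \<Longrightarrow> x \<noteq> u \<Longrightarrow>
      real (card (parcs G `` {x})) * (h x - 1) = (\<Sum>y\<in>parcs G `` {x}. h y)"
  shows "expected_hitting_time G v u = ennreal (h v)"
proof (rule expected_hitting_time_eqI[where V = V and C = "Max (h ` V)"])
  show "set_pmf (srw_step G x) \<subseteq> V" if "x \<in> V" for x
    using closed[OF that] finite_subset[OF _ fin, of "parcs G `` {x}"] by (simp add: srw_step_def)
  show "ennreal (h x) \<le> ennreal (Max (h ` V))" if "x \<in> V" for x
    using that fin by (intro ennreal_leI Max_ge) auto
  show "ennreal (h x) = 1 + (\<integral>\<^sup>+y. ennreal (h y) \<partial>srw_step G x)" if "x \<in> V" "x \<noteq> u" for x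
  proof -
    let ?N = "parcs G `` {x}"
    have N: "?N \<noteq> {}" "?N \<subseteq> V" "finite ?N"
      using closed[OF \<open>x \<in> V\<close>] fin by (auto intro: finite_subset)
    then have sum: "0 \<le> (\<Sum>y\<in>?N. h y)"
      using nonneg by (intro sum_nonneg) auto
    have card: "0 < real (card ?N)"
      using N by (simp add: card_gt_0_iff)
    have "(\<integral>\<^sup>+y. ennreal (h y) \<partial>srw_step G x) = (\<Sum>y\<in>?N. ennreal (h y)) / of_nat (card ?N)"
      unfolding srw_step_def using N by (simp add: nn_integral_pmf_of_set)
    also have "(\<Sum>y\<in>?N. ennreal (h y)) = ennreal (\<Sum>y\<in>?N. h y)"
      using N nonneg by (intro sum_ennreal) auto
    also have "\<dots> / of_nat (card ?N) = ennreal ((\<Sum>y\<in>?N. h y) / real (card ?N))"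
      using sum card by (simp add: divide_ennreal ennreal_of_nat_eq_real_of_nat)
    also have "1 + \<dots> = ennreal (1 + (\<Sum>y\<in>?N. h y) / real (card ?N))"
      using sum card by (subst ennreal_plus) simp_all
    also have "1 + (\<Sum>y\<in>?N. h y) / real (card ?N) = h x"
      using card by (simp add: h_step[OF that, symmetric])
    finally show ?thesis ..
  qed
qed (use v h_u in auto)

section \<open>Neighbourhoods in the tree\<close>

lemma mem_symcl_iff: "(x, y) \<in> symcl R \<longleftrightarrow> (x, y) \<in> R \<or> (y, x) \<in> R"
  by (force simp: symcl_def)

lemma arc_spine_tree_iff:
  "(Spine i, Spine j) \<in> parcs (spine_tree n k b) \<longleftrightarrow>
     (j = i + 1 \<and> 1 \<le> i \<and> i < n) \<or> (i = j + 1 \<and> 1 \<le> j \<and> j < n)"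
  "(Spine i, Leaf l) \<in> parcs (spine_tree n k b) \<longleftrightarrow> i = k \<and> 1 \<le> l \<and> l \<le> b"
  "(Leaf l, y) \<in> parcs (spine_tree n k b) \<longleftrightarrow> y = Spine k \<and> 1 \<le> l \<and> l \<le> b"
  by (auto simp: spine_tree_def mem_symcl_iff)

lemma mem_pverts_spine_tree_iff:
  "Spine i \<in> pverts (spine_tree n k b) \<longleftrightarrow> 1 \<le> i \<and> i \<le> n"
  "Leaf l \<in> pverts (spine_tree n k b) \<longleftrightarrow> 1 \<le> l \<and> l \<le> b"
  by (auto simp: spine_tree_def)

lemma Image_spine_tree_Spine:
  assumes "1 \<le> i" "i \<le> n"
  shows "parcs (spine_tree n k b) `` {Spine i} =
    (if i = 1 then {} else {Spine (i - 1)}) \<union> (if i = n then {} else {Spine (i + 1)}) \<union>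
    (if i = k then Leaf ` {1..b} else {})"
proof (rule set_eqI)
  show "y \<in> parcs (spine_tree n k b) `` {Spine i} \<longleftrightarrow>
      y \<in> (if i = 1 then {} else {Spine (i - 1)}) \<union> (if i = n then {} else {Spine (i + 1)}) \<union>
        (if i = k then Leaf ` {1..b} else {})" for y
    using assms by (cases y) (auto simp: arc_spine_tree_iff)
qed

lemma Image_spine_tree_Leaf:
  assumes "1 \<le> j" "j \<le> b"
  shows "parcs (spine_tree n k b) `` {Leaf j} = {Spine k}"
  using assms by (auto simp: arc_spine_tree_iff)

section \<open>The first-step equations on the tree\<close>

theorem theorem5:
  fixes n k b :: nat
  assumes "n \<ge> 3" and "2 \<le> k" and "k \<le> n - 1" and "b \<ge> 1"
  defines "t \<equiv> \<lambda>i. expected_hitting_time (spine_tree n k b) (Spine i) (Spine n)"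
  shows "(\<forall>i. 1 \<le> i \<and> i \<le> k - 1 \<longrightarrow>
            t i = ennreal ((real n)^2 - (real k)^2 + 2 * (real b - 1) * (real n - real k)
                           + (real k - 1)^2 - (real i - 1)^2)) \<and>
         (\<forall>i. k \<le> i \<and> i \<le> n - 1 \<longrightarrow>
            t i = ennreal ((real n)^2 - (real i)^2 + 2 * (real b - 1) * (real n - real i)))"
proof -
  let ?G = "spine_tree n k b"
  have kn: "k < n"
    using assms by linarith
  define far near :: "nat \<Rightarrow> real" where
    "far i = (real n)^2 - (real k)^2 + 2 * (real b - 1) * (real n - real k)
       + (real k - 1)^2 - (real i - 1)^2"
    and "near i = (real n)^2 - (real i)^2 + 2 * (real b - 1) * (real n - real i)" for i
  define s where "s i = (if i < k then far i else near i)" for i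
  define h where "h x = (case x of Spine i \<Rightarrow> s i | Leaf _ \<Rightarrow> s k + 1)" for x
  have h_simps [simp]: "h (Spine i) = s i" "h (Leaf j) = s k + 1" for i j
    by (simp_all add: h_def)
  have near_nonneg: "0 \<le> near i" if "i \<le> n" for i
    using that \<open>b \<ge> 1\<close> by (simp add: near_def)
  have far_eq: "far i = near k + ((real k - 1)^2 - (real i - 1)^2)" for i
    by (simp add: far_def near_def)
  have s_nonneg: "0 \<le> s i" if "1 \<le> i" "i \<le> n" for i
  proof (cases "i < k")
    case True
    then have "(real i - 1)^2 \<le> (real k - 1)^2"
      using that by (intro power_mono) auto
    then show ?thesis
      using True near_nonneg[of k] kn by (simp add: s_def far_eq)
  qed (use that near_nonneg in \<open>simp add: s_def\<close>)
  \<comment> \<open>The two formulas agree at \<open>k\<close>. Hence the equation at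
    \<open>k - 1\<close>, which involves the value at \<open>k\<close>, stays within the formula
    \<open>far\<close>.\<close>
  have s_le: "s i = far i" if "i \<le> k" for i
    using that by (auto simp: s_def far_eq)
  have s_ge: "s i = near i" if "k \<le> i" for i
    using that by (simp add: s_def)
  have hit: "t i = ennreal (s i)" if i: "1 \<le> i" "i \<le> n" for i
  proof -
    have "expected_hitting_time ?G (Spine i) (Spine n) = ennreal (h (Spine i))"
    proof (rule expected_hitting_time_finite_eqI[where V = "pverts ?G"])
      show "finite (pverts ?G)" "Spine i \<in> pverts ?G"
        using i by (simp_all add: spine_tree_def)
      show "parcs ?G `` {x} \<noteq> {} \<and> parcs ?G `` {x} \<subseteq> pverts ?G" if "x \<in> pverts ?G" for x
      proof (cases x)
        case (Spine j)
        then have "1 \<le> j" "j \<le> n"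
          using that by (auto simp: spine_tree_def)
        then show ?thesis
          using kn \<open>2 \<le> k\<close>
          by (auto simp: Spine Image_spine_tree_Spine mem_pverts_spine_tree_iff)
      next
        case (Leaf j)
        then have "1 \<le> j" "j \<le> b"
          using that by (auto simp: spine_tree_def)
        then show ?thesis
          using kn \<open>2 \<le> k\<close>
          by (simp add: Leaf Image_spine_tree_Leaf mem_pverts_spine_tree_iff)
      qed
      show "0 \<le> h x" if "x \<in> pverts ?G" for x
        using that s_nonneg s_nonneg[of k] kn \<open>2 \<le> k\<close> by (auto simp: spine_tree_def)
      show "h (Spine n) = 0"
        using kn by (simp add: s_ge near_def)
      show "real (card (parcs ?G `` {x})) * (h x - 1) = (\<Sum>y\<in>parcs ?G `` {x}. h y)"
        if x: "x \<in> pverts ?G" "x \<noteq> Spine n" for x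
      proof (cases x)
        case (Leaf j)
        then have "1 \<le> j" "j \<le> b"
          using x by (auto simp: spine_tree_def)
        then show ?thesis
          by (simp add: Leaf Image_spine_tree_Leaf)
      next
        case (Spine j)
        then have j: "1 \<le> j" "j < n"
          using x by (auto simp: spine_tree_def order.not_eq_order_implies_strict)
        note nbs = Image_spine_tree_Spine[of j n k b, OF j(1) less_imp_le[OF j(2)]]
        \<comment> \<open>The degrees are 1 at the left end, \<open>b + 2\<close> at the branching
          vertex and 2 at the other spine vertices considered.\<close>
        consider "j = 1" | "1 < j" "j < k" | "j = k" | "k < j"
          using j by linarith
        then show ?thesis
        proof cases
          case 1
          then have "parcs ?G `` {x} = {Spine 2}"
            using \<open>2 \<le> k\<close> kn unfolding Spine nbs by (auto simp: numeral_2_eq_2)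
          then show ?thesis
            using 1 \<open>2 \<le> k\<close> by (simp add: Spine s_le far_eq)
        next
          case 2
          then have "parcs ?G `` {x} = {Spine (j - 1), Spine (j + 1)}"
            using j unfolding Spine nbs by auto
          \<comment> \<open>\<open>far\<close> is a constant minus a square, and the second
            difference of a square is 2.\<close>
          moreover have "s (j - 1) + s (j + 1) = 2 * (s j - 1)"
            using 2 by (simp add: s_le far_eq of_nat_diff power2_eq_square algebra_simps)
          ultimately show ?thesis
            by (simp add: Spine)
        next
          case 3
          then have "parcs ?G `` {x} = {Spine (k - 1), Spine (k + 1)} \<union> Leaf ` {1..b}"
            using j \<open>2 \<le> k\<close> unfolding Spine nbs by auto
          moreover have "{Spine (k - 1), Spine (k + 1)} \<inter> Leaf ` {1..b} = {}"
            by auto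
          moreover have "card (Leaf ` {1..b}) = b" "sum h (Leaf ` {1..b}) = real b * (s k + 1)"
            by (simp_all add: card_image sum.reindex inj_on_def)
          \<comment> \<open>Here \<open>s (k - 1)\<close> is \<open>s k + 2k - 3\<close> and
            \<open>s (k + 1)\<close> is \<open>s k - 2k - 2b + 1\<close>. The terms in
            \<open>k\<close> cancel, and the \<open>b\<close> gained from the leaves leaves a total
            defect of \<open>b + 2\<close>, the degree.\<close>
          moreover have "s (k - 1) + s (k + 1) + real b * (s k + 1) = (2 + real b) * (s k - 1)"
            using \<open>2 \<le> k\<close>
            by (simp add: s_le[of "k - Suc 0"] s_ge far_eq near_def of_nat_diff power2_eq_square algebra_simps)
          ultimately show ?thesis
            using 3 by (simp add: Spine card_Un_disjoint sum.union_disjoint)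
        next
          case 4
          then have "parcs ?G `` {x} = {Spine (j - 1), Spine (j + 1)}"
            using j \<open>2 \<le> k\<close> unfolding Spine nbs by auto
          \<comment> \<open>Since \<open>j - 1\<close> is at least \<open>k\<close>, all three
            values come from \<open>near\<close>; its linear term has second difference 0.\<close>
          moreover have "s (j - 1) + s (j + 1) = 2 * (s j - 1)"
            using 4 by (simp add: s_ge near_def of_nat_diff power2_eq_square algebra_simps)
          ultimately show ?thesis
            by (simp add: Spine)
        qed
      qed
    qed
    then show ?thesis
      by (simp add: t_def)
  qed
  show ?thesis
    using hit kn \<open>2 \<le> k\<close> by (auto simp: s_le s_ge far_def near_def)
qed

end
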